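(* Let $n\ge 2$ and let $A\in\mathbb{R}^{(n+1)\times(n+1)}$ be the matrix $A$ associated with a consistent summation-by-parts (SBP) second derivative operator $D_2=H^{-1}(-A-\mathbf{e}_L\mathbf{d}_L^{\mathsf T}+\mathbf{e}_R\mathbf{d}_R^{\mathsf T})$ on the grid $x_i=i/n$, $i=0,\dots,n$. Let $\bar A$ denote the $(n-1)\times(n-1)$ submatrix of $A$ obtained by deleting its first and last rows and columns. If $\bar A$ is non-singular, so that $$G_2=\begin{bmatrix}0&0&0\\0&\bar A^{-1}&0\\0&0&0\end{bmatrix}\in\mathbb{R}^{(n+1)\times(n+1)}$$ exists, then the Moore–Penrose inverse of $A$ is $$A^+=\left(I-\frac{\mathbf{1}\mathbf{1}^{\mathsf T}}{n+1}\right)G_2\left(I-\frac{\mathbf{1}\mathbf{1}^{\mathsf T}}{n+1}\right)+\left(\mathbf{x}-\frac{\mathbf{1}}{2}\right)\left(\mathbf{x}-\frac{\mathbf{1}}{2}\right)^{\mathsf T},$$ where $I$ is the $(n+1)\times(n+1)$ identity matrix.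
   Context: Grid and vectors: $h=1/n$, $x_i=ih$ for $i=0,1,\dots,n$; in $\mathbb{R}^{n+1}$, $\mathbf{1}=[1,1,\dots,1]^{\mathsf T}$, $\mathbf{x}=[x_0,x_1,\dots,x_n]^{\mathsf T}$, $\mathbf{e}_L=[1,0,\dots,0]^{\mathsf T}$, $\mathbf{e}_R=[0,\dots,0,1]^{\mathsf T}$. A consistent SBP second derivative operator is a real $(n+1)\times(n+1)$ matrix $D_2=H^{-1}(-A-\mathbf{e}_L\mathbf{d}_L^{\mathsf T}+\mathbf{e}_R\mathbf{d}_R^{\mathsf T})$, where $H$ is symmetric positive definite, $A$ is symmetric positive semi-definite, and $\mathbf{d}_L,\mathbf{d}_R\in\mathbb{R}^{n+1}$ (approximations of the first derivative at the left and right boundaries), satisfying the consistency conditions $D_2\mathbf{1}=0$, $D_2\mathbf{x}=0$, $\mathbf{d}_L^{\mathsf T}\mathbf{1}=\mathbf{d}_R^{\mathsf T}\mathbf{1}=0$, $\mathbf{d}_L^{\mathsf T}\mathbf{x}=\mathbf{d}_R^{\mathsf T}\mathbf{x}=1$. (Consequently $A\mathbf{1}=0$ and $A\mathbf{x}=\mathbf{e}_R-\mathbf{e}_L$.) The Moore–Penrose inverse $A^+$ of a real matrix $A$ is the unique matrix with $AA^+A=A$, $A^+AA^+=A^+$, $(AA^+)^{\mathsf T}=AA^+$, $(A^+A)^{\mathsf T}=A^+A$. *)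

theory Defs
  imports
    "HOL.Real"
    "Jordan_Normal_Form.Gauss_Jordan_Elimination"
    "Jordan_Normal_Form.Determinant"
begin

text \<open>Vectors of \<open>\<real>\<^sup>n\<^sup>+\<^sup>1\<close> are indexed from \<open>0\<close> to \<open>n\<close>, matching the numbering of the grid points.\<close>

definition ones_vec :: "nat \<Rightarrow> real vec" where
  "ones_vec n = vec (n + 1) (\<lambda>_. 1)"

definition grid_vec :: "nat \<Rightarrow> real vec" where
  "grid_vec n = vec (n + 1) (\<lambda>i. real i / real n)"

abbreviation left_vec :: "nat \<Rightarrow> real vec" where
  "left_vec n \<equiv> unit_vec (n + 1) 0"

abbreviation right_vec :: "nat \<Rightarrow> real vec" where
  "right_vec n \<equiv> unit_vec (n + 1) n"

text \<open>The rank-one matrix \<open>u v\<^sup>T\<close>.\<close>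

definition outer_prod :: "real vec \<Rightarrow> real vec \<Rightarrow> real mat" where
  "outer_prod u v = mat (dim_vec u) (dim_vec v) (\<lambda>(i, j). u $ i * v $ j)"

definition sym_pos_def :: "nat \<Rightarrow> real mat \<Rightarrow> bool" where
  "sym_pos_def m M \<longleftrightarrow> M \<in> carrier_mat m m \<and> transpose_mat M = M \<and>
     (\<forall>v \<in> carrier_vec m. v \<noteq> 0\<^sub>v m \<longrightarrow> v \<bullet> (M *\<^sub>v v) > 0)"

definition sym_pos_semidef :: "nat \<Rightarrow> real mat \<Rightarrow> bool" where
  "sym_pos_semidef m M \<longleftrightarrow> M \<in> carrier_mat m m \<and> transpose_mat M = M \<and>
     (\<forall>v \<in> carrier_vec m. v \<bullet> (M *\<^sub>v v) \<ge> 0)"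

text \<open>
  The library function \<^const>\<open>mat_inverse\<close> is option-valued. The value below is only meaningful
  for invertible matrices; it is applied to a positive definite matrix and to a matrix that
  is assumed to be non-singular.
\<close>

abbreviation inv_mat :: "real mat \<Rightarrow> real mat" where
  "inv_mat M \<equiv> the (mat_inverse M)"

definition consistent_sbp2 ::
    "nat \<Rightarrow> real mat \<Rightarrow> real mat \<Rightarrow> real mat \<Rightarrow> real vec \<Rightarrow> real vec \<Rightarrow> bool" where
  "consistent_sbp2 n D2 H A dL dR \<longleftrightarrow>
     sym_pos_def (n + 1) H \<and> sym_pos_semidef (n + 1) A \<and>
     dL \<in> carrier_vec (n + 1) \<and> dR \<in> carrier_vec (n + 1) \<and>
     D2 = inv_mat H * (- A - outer_prod (left_vec n) dL + outer_prod (right_vec n) dR) \<and>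
     D2 *\<^sub>v ones_vec n = 0\<^sub>v (n + 1) \<and> D2 *\<^sub>v grid_vec n = 0\<^sub>v (n + 1) \<and>
     dL \<bullet> ones_vec n = 0 \<and> dR \<bullet> ones_vec n = 0 \<and>
     dL \<bullet> grid_vec n = 1 \<and> dR \<bullet> grid_vec n = 1"

definition interior_mat :: "nat \<Rightarrow> real mat \<Rightarrow> real mat" where
  "interior_mat n A = mat_delete (mat_delete A n n) 0 0"

text \<open>An \<open>(n-1) \<times> (n-1)\<close> matrix bordered by one zero row and column on each side.\<close>

definition zero_border :: "nat \<Rightarrow> real mat \<Rightarrow> real mat" where
  "zero_border n B =
     four_block_mat (0\<^sub>m 1 1) (0\<^sub>m 1 n)
       (0\<^sub>m n 1) (four_block_mat B (0\<^sub>m (n - 1) 1) (0\<^sub>m 1 (n - 1)) (0\<^sub>m 1 1))"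

definition is_moore_penrose_inverse :: "real mat \<Rightarrow> real mat \<Rightarrow> bool" where
  "is_moore_penrose_inverse A X \<longleftrightarrow>
     X \<in> carrier_mat (dim_col A) (dim_row A) \<and>
     A * X * A = A \<and> X * A * X = X \<and>
     transpose_mat (A * X) = A * X \<and> transpose_mat (X * A) = X * A"

lemma is_moore_penrose_inverse_unique:
  assumes "is_moore_penrose_inverse A X" and "is_moore_penrose_inverse A Y"
  shows "X = Y"
proof -
  obtain m k where A: "A \<in> carrier_mat m k" by blast
  have X: "X \<in> carrier_mat k m" and Y: "Y \<in> carrier_mat k m"
    using assms A by (auto simp: is_moore_penrose_inverse_def)
  have x: "A * X * A = A" "X * A * X = X"
      "transpose_mat (A * X) = A * X" "transpose_mat (X * A) = X * A"
    and y: "A * Y * A = A" "Y * A * Y = Y"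
      "transpose_mat (A * Y) = A * Y" "transpose_mat (Y * A) = Y * A"
    using assms by (auto simp: is_moore_penrose_inverse_def)
  have AX: "A * X \<in> carrier_mat m m" and AY: "A * Y \<in> carrier_mat m m"
    and XA: "X * A \<in> carrier_mat k k" and YA: "Y * A \<in> carrier_mat k k"
    using A X Y by auto
  have "(A * Y) * (A * X) = A * X"
    using assoc_mult_mat[OF AY A X] y(1) by simp
  hence "A * X = transpose_mat ((A * Y) * (A * X))" using x(3) by simp
  also have "\<dots> = (A * X) * (A * Y)"
    using transpose_mult[OF AY AX] x(3) y(3) by simp
  also have "\<dots> = A * Y"
    using assoc_mult_mat[OF AX A Y] x(1) by simp
  finally have 1: "A * X = A * Y" .
  have "(X * A) * (Y * A) = X * (A * (Y * A))"
    using assoc_mult_mat[OF X A YA] .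
  also have "A * (Y * A) = A" using assoc_mult_mat[OF A Y A] y(1) by simp
  finally have "X * A = transpose_mat ((X * A) * (Y * A))" using x(4) by simp
  also have "\<dots> = (Y * A) * (X * A)"
    using transpose_mult[OF XA YA] x(4) y(4) by simp
  also have "\<dots> = Y * (A * (X * A))" using assoc_mult_mat[OF Y A XA] .
  also have "A * (X * A) = A" using assoc_mult_mat[OF A X A] x(1) by simp
  finally have 2: "X * A = Y * A" .
  have "X = (X * A) * X" using x(2) by simp
  also have "\<dots> = Y * (A * X)" using 2 assoc_mult_mat[OF Y A X] by simp
  also have "\<dots> = Y * A * Y" using 1 assoc_mult_mat[OF Y A Y] by simp
  finally show ?thesis using y(2) by simp
qed

end

theory Submission
  imports Defs
begin

text \<open>
  Write \<open>P\<close> for the centering matrix \<open>I - 1 1\<^sup>T / (n + 1)\<close>, the orthogonal projection onto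
  \<open>1\<^sup>\<bottom>\<close>, and \<open>X\<close> for the claimed pseudoinverse. All four Penrose conditions follow at once
  (\<open>moore_penrose_of_symmetric\<close>) from \<open>A X = P\<close> together with the symmetry of \<open>A\<close>, \<open>X\<close>, \<open>P\<close>
  and the absorption laws \<open>A P = A\<close>, \<open>X P = X\<close>. Absorption by \<open>P\<close> only means that the constants
  lie in the kernel (\<open>mult_centering_mat\<close>).

  Consistency enters through \<open>A 1 = 0\<close> and \<open>A x = e\<^sub>R - e\<^sub>L\<close> (\<open>consistent_sbp2_stiffness\<close>): since
  \<open>H\<^sup>-\<^sup>1\<close> is injective, the two kernel conditions on \<open>D\<^sub>2\<close> are conditions on the bracket that it
  multiplies.

  The heart is the identity
  \<open>A G\<^sub>2 = I - e\<^sub>L 1\<^sup>T + (e\<^sub>L - e\<^sub>R) x\<^sup>T\<close> (\<open>stiffness_times_green\<close>). The matrix \<open>G\<^sub>2\<close> is a discrete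
  Green function with zero boundary values, so \<open>A G\<^sub>2\<close> is the identity at interior points; its
  first and last rows, which involve unknown boundary entries of \<open>A\<close>, are forced because every
  column of \<open>A G\<^sub>2\<close> is orthogonal to \<open>1\<close> and to \<open>x\<close>.

  With \<open>u = x - 1/2\<close> one has \<open>P 1 = 0\<close>, \<open>P x = u\<close> and \<open>A u = e\<^sub>R - e\<^sub>L\<close>. Multiplying the identity by
  \<open>P\<close> from the right gives \<open>A P G\<^sub>2 P = A G\<^sub>2 P = P - (e\<^sub>R - e\<^sub>L) u\<^sup>T\<close>, and the defect is exactly
  \<open>- A u u\<^sup>T\<close>: this is why the term \<open>u u\<^sup>T\<close> appears in \<open>X\<close>.
\<close>

section \<open>Rank-one matrices and inverses\<close>

lemma outer_prod_carrier [simp]: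
  "u \<in> carrier_vec m \<Longrightarrow> v \<in> carrier_vec k \<Longrightarrow> outer_prod u v \<in> carrier_mat m k"
  by (auto simp: outer_prod_def)

lemma outer_prod_dim [simp]:
  "dim_row (outer_prod u v) = dim_vec u" "dim_col (outer_prod u v) = dim_vec v"
  by (auto simp: outer_prod_def)

lemma outer_prod_index [simp]:
  "i < dim_vec u \<Longrightarrow> j < dim_vec v \<Longrightarrow> outer_prod u v $$ (i, j) = u $ i * v $ j"
  by (auto simp: outer_prod_def)

lemma transpose_outer_prod: "transpose_mat (outer_prod u v) = outer_prod v u"
  by (intro eq_matI) auto

lemma mult_outer_prod:
  assumes "M \<in> carrier_mat r m" "u \<in> carrier_vec m"
  shows "M * outer_prod u v = outer_prod (M *\<^sub>v u) v"
  using assms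
  by (intro eq_matI) (auto simp: scalar_prod_def sum_distrib_right mult.assoc)

lemma outer_prod_mult:
  assumes "M \<in> carrier_mat m c" "v \<in> carrier_vec m"
  shows "outer_prod u v * M = outer_prod u (transpose_mat M *\<^sub>v v)"
  using assms
  by (intro eq_matI) (auto simp: scalar_prod_def sum_distrib_left ac_simps)

lemma outer_prod_mult_vec:
  assumes "v \<in> carrier_vec m" "w \<in> carrier_vec m"
  shows "outer_prod u v *\<^sub>v w = (v \<bullet> w) \<cdot>\<^sub>v u"
  using assms
  by (intro eq_vecI) (auto simp: scalar_prod_def sum_distrib_right sum_distrib_left ac_simps)

lemma inv_mat_spec:
  assumes M: "M \<in> carrier_mat m m" and det: "det M \<noteq> 0"
  shows "M * inv_mat M = 1\<^sub>m m" "inv_mat M * M = 1\<^sub>m m" "inv_mat M \<in> carrier_mat m m"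
proof -
  have "mat_inverse M \<noteq> None"
    using mat_inverse(1)[OF M, of "()"] det_non_zero_imp_unit[OF M det, of "()"] by blast
  then obtain C where "mat_inverse M = Some C" by blast
  with mat_inverse(2)[OF M this]
  show "M * inv_mat M = 1\<^sub>m m" "inv_mat M * M = 1\<^sub>m m" "inv_mat M \<in> carrier_mat m m"
    by auto
qed

lemma invertible_mat_imp_det_nonzero:
  fixes M :: "real mat"
  assumes M: "M \<in> carrier_mat m m" and inv: "invertible_mat M"
  shows "det M \<noteq> 0"
proof -
  obtain C where C: "M * C = 1\<^sub>m m" "C * M = 1\<^sub>m (dim_row C)"
    using inv M by (auto simp: invertible_mat_def inverts_mat_def)
  have "C \<in> carrier_mat m m"
    using arg_cong[OF C(1), of dim_col] arg_cong[OF C(2), of dim_col] M by auto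
  then have "det M * det C = 1" using det_mult[OF M] C(1) by (metis det_one)
  then show ?thesis by auto
qed

text \<open>
  A kernel vector \<open>v \<noteq> 0\<close> would make the quadratic form vanish at \<open>v\<close>.
\<close>

lemma sym_pos_def_det_nonzero:
  assumes "sym_pos_def m H"
  shows "det H \<noteq> 0"
proof
  assume "det H = 0"
  moreover have H: "H \<in> carrier_mat m m" using assms by (simp add: sym_pos_def_def)
  ultimately obtain v where "v \<in> carrier_vec m" "v \<noteq> 0\<^sub>v m" "H *\<^sub>v v = 0\<^sub>v m"
    using det_0_iff_vec_prod_zero by blast
  then show False using assms by (force simp: sym_pos_def_def)
qed

text \<open>
  Transposing \<open>B C = I\<close> makes \<open>C\<^sup>T\<close> a left inverse of \<open>B\<close>, and a left inverse equals a right inverse.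
\<close>

lemma inverse_of_symmetric_is_symmetric:
  fixes B :: "real mat"
  assumes B: "B \<in> carrier_mat m m" and C: "C \<in> carrier_mat m m"
    and sym: "transpose_mat B = B" and BC: "B * C = 1\<^sub>m m"
  shows "transpose_mat C = C"
proof -
  have "transpose_mat C * B = 1\<^sub>m m"
    using transpose_mult[OF B C] BC sym by simp
  then have "transpose_mat C * B * C = C" using C by simp
  moreover have "transpose_mat C * B * C = transpose_mat C * (B * C)"
    using assoc_mult_mat[of "transpose_mat C" m m B m C m] B C by auto
  ultimately show ?thesis using BC C by simp
qed

lemma symmetric_mat_self_adjoint:
  fixes M :: "real mat"
  assumes "M \<in> carrier_mat m m" "transpose_mat M = M" "v \<in> carrier_vec m" "w \<in> carrier_vec m"
  shows "v \<bullet> (M *\<^sub>v w) = (M *\<^sub>v v) \<bullet> w"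
  using transpose_vec_mult_scalar[of M m m w v] assms by simp

text \<open>
  Transposing the three product identities gives \<open>X A = P\<close>, \<open>P A = A\<close> and \<open>P X = X\<close>. Hence the two
  products \<open>A X\<close> and \<open>X A\<close> are the same symmetric matrix, which acts as an identity on both factors.
\<close>

lemma moore_penrose_of_symmetric:
  assumes A: "A \<in> carrier_mat m m" and X: "X \<in> carrier_mat m m"
    and symA: "transpose_mat A = A" and symX: "transpose_mat X = X"
    and P: "P \<in> carrier_mat m m" and symP: "transpose_mat P = P"
    and AX: "A * X = P" and AP: "A * P = A" and XP: "X * P = X"
  shows "is_moore_penrose_inverse A X"
proof -
  have XA: "X * A = P"
    using transpose_mult[OF A X] symA symX symP AX by simp
  have "P * A = A" using transpose_mult[OF A P] symA symP AP by simp
  moreover have "P * X = X" using transpose_mult[OF X P] symX symP XP by simp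
  ultimately show ?thesis
    using A X AX XA symP by (simp add: is_moore_penrose_inverse_def)
qed

section \<open>The centering projection\<close>

definition centering_mat :: "nat \<Rightarrow> real mat" where
  "centering_mat n =
     1\<^sub>m (n + 1) - (1 / real (n + 1)) \<cdot>\<^sub>m outer_prod (ones_vec n) (ones_vec n)"

lemma ones_vec_carrier: "ones_vec n \<in> carrier_vec (n + 1)"
  and grid_vec_carrier: "grid_vec n \<in> carrier_vec (n + 1)"
  by (simp_all add: ones_vec_def grid_vec_def)

lemmas [simp] = ones_vec_carrier[simplified] grid_vec_carrier[simplified]

lemma dim_ones_grid [simp]: "dim_vec (ones_vec n) = n + 1" "dim_vec (grid_vec n) = n + 1"
  by (simp_all add: ones_vec_def grid_vec_def)

lemma centering_mat_carrier: "centering_mat n \<in> carrier_mat (n + 1) (n + 1)"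
  by (rule carrier_matI) (simp_all add: centering_mat_def)

lemmas [simp] = centering_mat_carrier[simplified]

lemma transpose_centering_mat: "transpose_mat (centering_mat n) = centering_mat n"
  by (intro eq_matI) (auto simp: centering_mat_def ones_vec_def)

lemma centering_mat_mult_vec:
  assumes v: "v \<in> carrier_vec (n + 1)"
  shows "centering_mat n *\<^sub>v v = v - ((ones_vec n \<bullet> v) / real (n + 1)) \<cdot>\<^sub>v ones_vec n"
proof -
  let ?J = "outer_prod (ones_vec n) (ones_vec n)"
  have "((1 / real (n + 1)) \<cdot>\<^sub>m ?J) *\<^sub>v v = (1 / real (n + 1)) \<cdot>\<^sub>v (?J *\<^sub>v v)"
    using v by (intro eq_vecI) (auto simp: scalar_prod_def sum_distrib_left ones_vec_def simp del: sum.op_ivl_Suc)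
  then show ?thesis
    using v
    by (simp add: centering_mat_def minus_mult_distrib_mat_vec[of _ "n + 1" "n + 1"]
        outer_prod_mult_vec[of _ "n + 1"] smult_smult_assoc)
qed

lemma centering_mat_ones: "centering_mat n *\<^sub>v ones_vec n = 0\<^sub>v (n + 1)"
  by (subst centering_mat_mult_vec) (auto simp: scalar_prod_def ones_vec_def)

text \<open>
  The grid is symmetric about the midpoint of the unit interval, so the mean of its points is \<open>1/2\<close>.
\<close>

lemma centering_mat_grid:
  assumes "n > 0"
  shows "centering_mat n *\<^sub>v grid_vec n = grid_vec n - (1 / 2) \<cdot>\<^sub>v ones_vec n"
proof -
  have "(\<Sum>i = 0..<n + 1. real i) = real n * (real n + 1) / 2"
    by (induction n) (simp_all add: field_simps)
  then have "ones_vec n \<bullet> grid_vec n = (real n + 1) / 2"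
    using assms by (simp add: scalar_prod_def ones_vec_def grid_vec_def del: sum.op_ivl_Suc flip: sum_divide_distrib)
  then have "(ones_vec n \<bullet> grid_vec n) / real (n + 1) = 1 / 2" by simp
  then show ?thesis by (simp only: centering_mat_mult_vec[OF grid_vec_carrier])
qed

text \<open>
  The rank-one part of the centering matrix contributes a multiple of \<open>(M 1) 1\<^sup>T\<close>.
\<close>

lemma mult_centering_mat:
  assumes M: "M \<in> carrier_mat m (n + 1)" and M1: "M *\<^sub>v ones_vec n = 0\<^sub>v m"
  shows "M * centering_mat n = M"
proof -
  let ?J = "outer_prod (ones_vec n) (ones_vec n)"
  have J: "?J \<in> carrier_mat (n + 1) (n + 1)" by simp
  have "M * ?J = 0\<^sub>m m (n + 1)"
    using mult_outer_prod[OF M, of "ones_vec n" "ones_vec n"] M1 by (auto intro!: eq_matI)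
  then show ?thesis
    using M mult_smult_distrib[OF M J, of "1 / real (n + 1)"]
      mult_minus_distrib_mat[OF M one_carrier_mat smult_carrier_mat[OF J], of "1 / real (n + 1)"]
    unfolding centering_mat_def by (auto intro!: eq_matI)
qed

section \<open>The discrete Green function\<close>

lemma interior_mat_carrier:
  "A \<in> carrier_mat (n + 1) (n + 1) \<Longrightarrow> interior_mat n A \<in> carrier_mat (n - 1) (n - 1)"
  by (simp add: interior_mat_def mat_delete_def)

lemma interior_mat_index:
  assumes "A \<in> carrier_mat (n + 1) (n + 1)" "i < n - 1" "j < n - 1"
  shows "interior_mat n A $$ (i, j) = A $$ (Suc i, Suc j)"
  using assms by (auto simp: interior_mat_def mat_delete_def)

lemma zero_border_carrier:
  assumes "n > 0" "C \<in> carrier_mat (n - 1) (n - 1)"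
  shows "zero_border n C \<in> carrier_mat (n + 1) (n + 1)"
  using assms by (auto simp: zero_border_def)

lemma zero_border_index:
  assumes "C \<in> carrier_mat (n - 1) (n - 1)" "i \<le> n" "j \<le> n" "n > 0"
  shows "zero_border n C $$ (i, j) =
    (if 0 < i \<and> i < n \<and> 0 < j \<and> j < n then C $$ (i - 1, j - 1) else 0)"
  using assms by (auto simp: zero_border_def)

lemma sum_split_endpoints:
  fixes f :: "nat \<Rightarrow> real"
  assumes "n > 0"
  shows "(\<Sum>i = 0..<n + 1. f i) = f 0 + (\<Sum>i = 0..<n - 1. f (Suc i)) + f n"
proof -
  obtain m where "n = Suc m" using assms by (cases n) auto
  then show ?thesis
    using sum.atLeast0_lessThan_Suc_shift[of f m] by (simp add: algebra_simps)
qed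

text \<open>
  The zero rows of the bordered matrix suppress the two boundary columns of \<open>A\<close>.
\<close>

lemma mult_zero_border_interior:
  assumes A: "A \<in> carrier_mat (n + 1) (n + 1)" and C: "C \<in> carrier_mat (n - 1) (n - 1)"
    and i: "0 < i" "i < n" and j: "0 < j" "j < n"
  shows "(A * zero_border n C) $$ (i, j) = (interior_mat n A * C) $$ (i - 1, j - 1)"
proof -
  have G: "zero_border n C \<in> carrier_mat (n + 1) (n + 1)"
    using zero_border_carrier C i by simp
  have "(A * zero_border n C) $$ (i, j)
      = (\<Sum>k = 0..<n + 1. A $$ (i, k) * zero_border n C $$ (k, j))"
    using A G i j by (simp add: scalar_prod_def)
  also have "\<dots> = (\<Sum>k = 0..<n - 1. A $$ (i, Suc k) * C $$ (k, j - 1))"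
    using C i j by (subst sum_split_endpoints)
      (auto simp: zero_border_index intro!: sum.cong)
  also have "\<dots> = (\<Sum>k = 0..<n - 1. interior_mat n A $$ (i - 1, k) * C $$ (k, j - 1))"
    using A i j by (intro sum.cong) (simp_all add: interior_mat_index)
  also have "\<dots> = (interior_mat n A * C) $$ (i - 1, j - 1)"
    using interior_mat_carrier[OF A] C i j by (simp add: scalar_prod_def)
  finally show ?thesis .
qed

text \<open>
  The zeroth and first moments give two linear equations for the two end entries; they are
  independent because the end points \<open>0\<close> and \<open>1\<close> of the grid are distinct.
\<close>

lemma endpoints_from_moments:
  assumes n: "n > 0" and v: "v \<in> carrier_vec (n + 1)"
    and moments: "ones_vec n \<bullet> v = 0" "grid_vec n \<bullet> v = 0"
    and j: "0 < j" "j < n"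
    and interior: "\<And>i. 0 < i \<Longrightarrow> i < n \<Longrightarrow> v $ i = (if i = j then 1 else 0)"
  shows "v $ n = - (real j / real n)" "v $ 0 = real j / real n - 1"
proof -
  have v_Suc: "v $ Suc k = (if k = j - 1 then 1 else 0)" if "k < n - 1" for k
    using interior[of "Suc k"] that j by auto
  have split: "(\<Sum>i = 0..<n + 1. c i * v $ i) = c 0 * v $ 0 + c j + c n * v $ n"
    for c :: "nat \<Rightarrow> real"
  proof -
    have "(\<Sum>k = 0..<n - 1. c (Suc k) * v $ Suc k)
        = (\<Sum>k = 0..<n - 1. if k = j - 1 then c (Suc k) else 0)"
      by (intro sum.cong) (auto simp: v_Suc)
    also have "\<dots> = c j" using j by simp
    finally show ?thesis
      using n sum_split_endpoints[of n "\<lambda>i. c i * v $ i"] by simp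
  qed
  have "ones_vec n \<bullet> v = (\<Sum>i = 0..<n + 1. 1 * v $ i)"
    using v by (simp add: scalar_prod_def ones_vec_def del: sum.op_ivl_Suc)
  then have sum0: "v $ 0 + 1 + v $ n = 0" using split[of "\<lambda>_. 1"] moments(1) by simp
  have "grid_vec n \<bullet> v = (\<Sum>i = 0..<n + 1. (real i / real n) * v $ i)"
    using v by (simp add: scalar_prod_def grid_vec_def del: sum.op_ivl_Suc)
  then have "real j / real n + v $ n = 0" 
    using split[of "\<lambda>i. real i / real n"] moments(2) n by simp
  with sum0 show "v $ n = - (real j / real n)" "v $ 0 = real j / real n - 1" by auto
qed

text \<open>
  For an interior column \<open>j\<close>, the interior entries of \<open>A G\<close> come from the inverse of the interior block.
  By symmetry of \<open>A\<close>, the moments of that column are \<open>(A 1)\<^sup>T G e\<^sub>j = 0\<close> and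
  \<open>(A x)\<^sup>T G e\<^sub>j = (e\<^sub>R - e\<^sub>L)\<^sup>T G e\<^sub>j\<close>, which vanishes because \<open>G\<close> has zero boundary rows; so
  \<open>endpoints_from_moments\<close> supplies the entries \<open>j/n - 1\<close> and \<open>- j/n\<close> in the first and last row.
  On the right-hand side the three terms cancel in the columns \<open>j = 0\<close> and \<open>j = n\<close>, where \<open>G\<close> is zero.
\<close>

lemma stiffness_times_green:
  assumes n: "n > 0" and A: "A \<in> carrier_mat (n + 1) (n + 1)" and sym: "transpose_mat A = A"
    and A1: "A *\<^sub>v ones_vec n = 0\<^sub>v (n + 1)"
    and Ax: "A *\<^sub>v grid_vec n = right_vec n - left_vec n"
    and C: "C \<in> carrier_mat (n - 1) (n - 1)"
    and inv: "interior_mat n A * C = 1\<^sub>m (n - 1)"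
  shows "A * zero_border n C = 1\<^sub>m (n + 1) - outer_prod (left_vec n) (ones_vec n)
    + outer_prod (left_vec n - right_vec n) (grid_vec n)" (is "?M = ?R")
proof (rule eq_matI)
  let ?G = "zero_border n C"
  have G: "?G \<in> carrier_mat (n + 1) (n + 1)" using zero_border_carrier n C by simp
  fix i j assume "i < dim_row ?R" "j < dim_col ?R"
  then have ij: "i \<le> n" "j \<le> n" by auto
  have gc: "col ?G j \<in> carrier_vec (n + 1)" using G ij by (metis carrier_matD(1) col_dim)
  have col: "col ?M j = A *\<^sub>v col ?G j" using A G ij by (simp add: col_mult2[of _ "n + 1" "n + 1"])
  have entry: "?M $$ (k, j) = col ?M j $ k" if "k \<le> n" for k
    using A G ij that by simp
  show "?M $$ (i, j) = ?R $$ (i, j)"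
  proof (cases "0 < j \<and> j < n")
    case True
    have moment: "v \<bullet> col ?M j = (A *\<^sub>v v) \<bullet> col ?G j" if "v \<in> carrier_vec (n + 1)" for v
      unfolding col using symmetric_mat_self_adjoint[OF A sym that gc] .
    have m1: "ones_vec n \<bullet> col ?M j = 0"
      using moment[of "ones_vec n"] A1 gc by simp
    have mx: "grid_vec n \<bullet> col ?M j = 0"
    proof -
      have "(right_vec n - left_vec n) \<bullet> col ?G j = ?G $$ (n, j) - ?G $$ (0, j)"
        using gc G ij by (simp add: minus_scalar_prod_distrib[of _ "n + 1"])
      then show ?thesis
        using moment[of "grid_vec n"] Ax zero_border_index[OF C] n ij by simp
    qed
    have int: "col ?M j $ k = (if k = j then 1 else 0)" if "0 < k" "k < n" for k
      using mult_zero_border_interior[OF A C that, of j] True inv entry[of k] that by auto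
    have c: "col ?M j \<in> carrier_vec (n + 1)"
      using A unfolding col by (rule mult_mat_vec_carrier) (rule gc)
    have ends: "col ?M j $ n = - (real j / real n)" "col ?M j $ 0 = real j / real n - 1"
      using endpoints_from_moments[OF n c m1 mx _ _ int] True by auto
    show ?thesis
      using entry[OF ij(1)] int[of i] ends True ij n
      by (cases "i = 0"; cases "i = n") (auto simp: ones_vec_def grid_vec_def)
  next
    case False
    then have "col ?G j = 0\<^sub>v (n + 1)"
      using G ij n C by (intro eq_vecI) (auto simp: zero_border_index)
    then have "?M $$ (i, j) = 0"
      using entry[OF ij(1)] col A ij by (simp add: scalar_prod_def)
    moreover have "j = 0 \<or> j = n" using False ij by auto
    ultimately show ?thesis
      using ij n by (auto simp: ones_vec_def grid_vec_def)
  qed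
qed (use A zero_border_carrier[OF n C] in auto)

section \<open>The pseudoinverse of the stiffness matrix\<close>

text \<open>
  Multiplying \<open>D\<^sub>2 v = 0\<close> by \<open>H\<close> leaves \<open>A v = (d\<^sub>R\<^sup>T v) e\<^sub>R - (d\<^sub>L\<^sup>T v) e\<^sub>L\<close>. The boundary derivatives
  annihilate constants and are exact on \<open>x\<close>, so the coefficients are \<open>0\<close> for \<open>v = 1\<close> and \<open>1\<close> for \<open>v = x\<close>.
\<close>

lemma consistent_sbp2_stiffness:
  assumes "consistent_sbp2 n D2 H A dL dR"
  shows "A *\<^sub>v ones_vec n = 0\<^sub>v (n + 1)"
    and "A *\<^sub>v grid_vec n = right_vec n - left_vec n"
proof -
  let ?S = "- A - outer_prod (left_vec n) dL + outer_prod (right_vec n) dR"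
  have H: "sym_pos_def (n + 1) H" and A: "A \<in> carrier_mat (n + 1) (n + 1)"
    and dL: "dL \<in> carrier_vec (n + 1)" and dR: "dR \<in> carrier_vec (n + 1)"
    and D2: "D2 = inv_mat H * ?S"
    and D2_1: "D2 *\<^sub>v ones_vec n = 0\<^sub>v (n + 1)" and D2_x: "D2 *\<^sub>v grid_vec n = 0\<^sub>v (n + 1)"
    and d: "dL \<bullet> ones_vec n = 0" "dR \<bullet> ones_vec n = 0" "dL \<bullet> grid_vec n = 1" "dR \<bullet> grid_vec n = 1"
    using assms by (auto simp: consistent_sbp2_def sym_pos_semidef_def)
  have Hc: "H \<in> carrier_mat (n + 1) (n + 1)" using H by (simp add: sym_pos_def_def)
  note Hinv = inv_mat_spec[OF Hc sym_pos_def_det_nonzero[OF H]]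
  have S: "?S \<in> carrier_mat (n + 1) (n + 1)" using A dL dR by simp
  have kernel: "?S *\<^sub>v v = 0\<^sub>v (n + 1)"
    if v: "v \<in> carrier_vec (n + 1)" and D2v: "D2 *\<^sub>v v = 0\<^sub>v (n + 1)" for v
  proof -
    have Sv: "?S *\<^sub>v v \<in> carrier_vec (n + 1)" using S v by (rule mult_mat_vec_carrier)
    have "inv_mat H *\<^sub>v (?S *\<^sub>v v) = 0\<^sub>v (n + 1)"
      using assoc_mult_mat_vec[OF Hinv(3) S v] D2v D2 by simp
    then have "H *\<^sub>v (inv_mat H *\<^sub>v (?S *\<^sub>v v)) = 0\<^sub>v (n + 1)" using Hc by auto
    then show ?thesis
      using assoc_mult_mat_vec[OF Hc Hinv(3) Sv] Hinv(1) Sv by simp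
  qed
  have expand: "?S *\<^sub>v v
      = - (A *\<^sub>v v) - (dL \<bullet> v) \<cdot>\<^sub>v left_vec n + (dR \<bullet> v) \<cdot>\<^sub>v right_vec n"
    if v: "v \<in> carrier_vec (n + 1)" for v
  proof -
    have L: "outer_prod (left_vec n) dL \<in> carrier_mat (n + 1) (n + 1)"
      and R: "outer_prod (right_vec n) dR \<in> carrier_mat (n + 1) (n + 1)"
      using dL dR by auto
    have A': "- A \<in> carrier_mat (n + 1) (n + 1)" using A by simp
    show ?thesis
      using add_mult_distrib_mat_vec[OF minus_carrier_mat[OF L] R v]
        minus_mult_distrib_mat_vec[OF A' L v] A v
      by (simp add: outer_prod_mult_vec[OF dL v] outer_prod_mult_vec[OF dR v])
  qed
  have Av: "(A *\<^sub>v v) $ i = (dR \<bullet> v) * right_vec n $ i - (dL \<bullet> v) * left_vec n $ i"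
    if "v \<in> carrier_vec (n + 1)" "D2 *\<^sub>v v = 0\<^sub>v (n + 1)" "i < n + 1" for v i
  proof -
    have "(?S *\<^sub>v v) $ i = 0" using kernel[OF that(1,2)] that(3) by simp
    then show ?thesis
      unfolding expand[OF that(1)] using A that(3)
      by (auto simp del: index_mult_mat_vec)
  qed
  show "A *\<^sub>v ones_vec n = 0\<^sub>v (n + 1)"
    using A Av[OF ones_vec_carrier D2_1] d by (intro eq_vecI) auto
  show "A *\<^sub>v grid_vec n = right_vec n - left_vec n"
    using A Av[OF grid_vec_carrier D2_x] d by (intro eq_vecI) (auto simp del: index_mult_mat_vec)
qed

theorem theorem3p1:
  fixes n :: nat and D2 H A :: "real mat" and dL dR :: "real vec"
  assumes "n \<ge> 2"
    and "consistent_sbp2 n D2 H A dL dR"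
    and "invertible_mat (interior_mat n A)"
  defines "G2 \<equiv> zero_border n (inv_mat (interior_mat n A))"
    and "P \<equiv> 1\<^sub>m (n + 1) - (1 / real (n + 1)) \<cdot>\<^sub>m outer_prod (ones_vec n) (ones_vec n)"
    and "u \<equiv> grid_vec n - (1 / 2) \<cdot>\<^sub>v ones_vec n"
  shows "is_moore_penrose_inverse A (P * G2 * P + outer_prod u u)"
proof -
  let ?N = "n + 1" and ?C = "inv_mat (interior_mat n A)"
  let ?l = "left_vec n" and ?r = "right_vec n" and ?o = "ones_vec n" and ?x = "grid_vec n"
  let ?X = "P * G2 * P + outer_prod u u"
  have n: "n > 0" using assms(1) by simp
  have A: "A \<in> carrier_mat ?N ?N" and symA: "transpose_mat A = A"
    using assms(2) by (auto simp: consistent_sbp2_def sym_pos_semidef_def)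
  note A1 = consistent_sbp2_stiffness(1)[OF assms(2)]
    and Ax = consistent_sbp2_stiffness(2)[OF assms(2)]
  have P_eq: "P = centering_mat n" by (simp add: P_def centering_mat_def)
  have P: "P \<in> carrier_mat ?N ?N" and symP: "transpose_mat P = P"
    and P1: "P *\<^sub>v ?o = 0\<^sub>v ?N"
    by (simp_all only: P_eq transpose_centering_mat centering_mat_ones centering_mat_carrier)
  have Px: "P *\<^sub>v ?x = u" by (simp add: P_eq centering_mat_grid n u_def)
  have u: "u \<in> carrier_vec ?N" using P Px by auto
  have B: "interior_mat n A \<in> carrier_mat (n - 1) (n - 1)" using interior_mat_carrier[OF A] .
  note C = inv_mat_spec[OF B invertible_mat_imp_det_nonzero[OF B assms(3)]]
  have symB: "transpose_mat (interior_mat n A) = interior_mat n A"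
  proof (rule eq_matI)
    fix i j assume "i < dim_row (interior_mat n A)" "j < dim_col (interior_mat n A)"
    then have ij: "i < n - 1" "j < n - 1" using B by auto
    have "A $$ (Suc j, Suc i) = transpose_mat A $$ (Suc i, Suc j)"
      using A ij by simp
    then show "transpose_mat (interior_mat n A) $$ (i, j) = interior_mat n A $$ (i, j)"
      using B ij symA by (simp add: interior_mat_index[OF A])
  qed (use B in auto)
  have symC: "transpose_mat ?C = ?C"
    using inverse_of_symmetric_is_symmetric[OF B C(3) symB C(1)] .
  have G: "G2 \<in> carrier_mat ?N ?N" using zero_border_carrier[OF n C(3)] by (simp add: G2_def)
  have symG: "transpose_mat G2 = G2"
  proof (rule eq_matI)
    fix i j assume "i < dim_row G2" "j < dim_col G2"
    then have ij: "i \<le> n" "j \<le> n" using G by auto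
    have "?C $$ (a, b) = ?C $$ (b, a)" if "a < n - 1" "b < n - 1" for a b
      using arg_cong[OF symC, of "\<lambda>M. M $$ (b, a)"] that C(3) by simp
    then show "transpose_mat G2 $$ (i, j) = G2 $$ (i, j)"
      using G ij n by (auto simp: G2_def zero_border_index[OF C(3)])
  qed (use G in auto)
  have PG: "P * G2 \<in> carrier_mat ?N ?N" and PGP: "P * G2 * P \<in> carrier_mat ?N ?N"
    and uu: "outer_prod u u \<in> carrier_mat ?N ?N"
    using P G u by auto
  have X: "?X \<in> carrier_mat ?N ?N" using PGP uu by simp
  have "transpose_mat (P * G2 * P) = P * (G2 * P)"
    using transpose_mult[OF PG P] transpose_mult[OF P G] symP symG by simp
  then have symX: "transpose_mat ?X = ?X"
    using transpose_add[OF PGP uu] assoc_mult_mat[OF P G P] by (simp add: transpose_outer_prod)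
  have AP: "A * P = A" using mult_centering_mat[OF A A1] by (simp add: P_eq)

  \<comment> \<open>\<open>u\<close> lies in the range of the projection \<open>P\<close>, hence is orthogonal to the constants.\<close>
  have "u \<bullet> ?o = (P *\<^sub>v ?x) \<bullet> ?o" by (simp add: Px)
  also have "\<dots> = ?x \<bullet> (P *\<^sub>v ?o)"
    using symmetric_mat_self_adjoint[OF P symP grid_vec_carrier ones_vec_carrier] by simp
  finally have u1: "u \<bullet> ?o = 0" by (simp add: P1 scalar_prod_right_zero[of _ ?N])
  have PG0: "P * G2 *\<^sub>v 0\<^sub>v ?N = 0\<^sub>v ?N"
    using PG by (intro eq_vecI) (auto simp: scalar_prod_def)
  have "?X *\<^sub>v ?o = P * G2 *\<^sub>v (P *\<^sub>v ?o) + (u \<bullet> ?o) \<cdot>\<^sub>v u"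
    using add_mult_distrib_mat_vec[OF PGP uu ones_vec_carrier]
      assoc_mult_mat_vec[OF PG P ones_vec_carrier] outer_prod_mult_vec[OF u ones_vec_carrier]
    by simp
  also have "\<dots> = 0\<^sub>v ?N" unfolding P1 u1 PG0 using u by auto
  finally have XP: "?X * P = ?X" using mult_centering_mat[OF X] by (simp add: P_eq)

  have Au: "A *\<^sub>v u = ?r - ?l"
    using A A1 Ax
    by (auto simp: u_def mult_minus_distrib_mat_vec[of _ ?N ?N] mult_mat_vec[of _ ?N ?N])
  have AG: "A * G2 = 1\<^sub>m ?N - outer_prod ?l ?o + outer_prod (?l - ?r) ?x"
    using stiffness_times_green[OF n A symA A1 Ax C(3) C(1)] by (simp add: G2_def)
  have AGP: "A * G2 * P = P - outer_prod ?l (0\<^sub>v ?N) + outer_prod (?l - ?r) u"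
  proof -
    have L: "outer_prod ?l ?o \<in> carrier_mat ?N ?N"
      and R: "outer_prod (?l - ?r) ?x \<in> carrier_mat ?N ?N"
      by (rule carrier_matI; simp)+
    show ?thesis
      unfolding AG add_mult_distrib_mat[OF minus_carrier_mat[OF L] R P]
        minus_mult_distrib_mat[OF one_carrier_mat L P]
        outer_prod_mult[OF P ones_vec_carrier] outer_prod_mult[OF P grid_vec_carrier]
        symP P1 Px left_mult_one_mat[OF P] ..
  qed
  \<comment> \<open>The left factor \<open>P\<close> is absorbed by \<open>A\<close>, and the two rank-one terms cancel.\<close>
  have "A * (P * G2 * P) = A * G2 * P"
    using assoc_mult_mat[OF A PG P] assoc_mult_mat[OF A P G] AP by simp
  then have "A * ?X = A * G2 * P + outer_prod (?r - ?l) u"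
    using mult_add_distrib_mat[OF A PGP uu] mult_outer_prod[OF A u] Au by simp
  also have "\<dots> = P"
    unfolding AGP using P u by (intro eq_matI) (auto simp: algebra_simps)
  finally have AX: "A * ?X = P" .
  show ?thesis
    using moore_penrose_of_symmetric[OF A X symA symX P symP AX AP XP] .
qed

end
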